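(* For every $n\geq 1$, the ladder graph $L_n$ satisfies $$\mu(L_n)=\left\lceil\frac{n+1}{2}\right\rceil.$$
   Context: The ladder graph $L_n$ with $n$ rungs is the Cartesian product of $K_2$ and the path $P_n$ on $n$ vertices: its vertices are $x_1,\ldots,x_n,y_1,\ldots,y_n$ and its edges are $x_iy_i$ ($1\leq i\leq n$, the rungs), $x_ix_{i+1}$ and $y_iy_{i+1}$ ($1\leq i\leq n-1$). For a graph $G$, $\mu(G)$ denotes the minimum size of a maximal (with respect to inclusion) independent vertex set of $G$. *)

theory Defs
  imports Complex_Main "Graph_Theory.Graph_Theory"
begin

text \<open>An undirected simple graph is, as in \<^theory>\<open>Graph_Theory.Digraph\<close>, a loop-free
  symmetric digraph: the undirected edge \<open>uv\<close> is the pair of arcs \<open>(u, v)\<close> and \<open>(v, u)\<close>.\<close>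

definition independent_set :: "('a, 'b) pre_digraph \<Rightarrow> 'a set \<Rightarrow> bool" where
  "independent_set G S \<longleftrightarrow> S \<subseteq> verts G \<and> (\<forall>u\<in>S. \<forall>v\<in>S. \<not> u \<rightarrow>\<^bsub>G\<^esub> v)"

definition maximal_independent_set :: "('a, 'b) pre_digraph \<Rightarrow> 'a set \<Rightarrow> bool" where
  "maximal_independent_set G S \<longleftrightarrow>
     independent_set G S \<and> (\<forall>T. independent_set G T \<and> S \<subseteq> T \<longrightarrow> T = S)"

text \<open>Meaningful for finite graphs only, where the minimum is over a finite nonempty set.\<close>

definition min_maximal_independent :: "('a, 'b) pre_digraph \<Rightarrow> nat" (\<open>\<mu>\<close>) where
  "\<mu> G = Min (card ` {S. maximal_independent_set G S})"

lemma finite_maximal_independent_sets: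
  assumes "finite (verts G)"
  shows "finite {S. maximal_independent_set G S}"
  by (rule finite_subset[of _ "Pow (verts G)"])
     (use assms in \<open>auto simp: maximal_independent_set_def independent_set_def\<close>)

lemma maximal_independent_set_exists:
  assumes "finite (verts G)"
  shows "{S. maximal_independent_set G S} \<noteq> {}"
proof -
  let ?I = "{S. independent_set G S}"
  have "finite ?I"
    by (rule finite_subset[of _ "Pow (verts G)"])
       (use assms in \<open>auto simp: independent_set_def\<close>)
  moreover have "{} \<in> ?I" by (simp add: independent_set_def)
  ultimately obtain S where "S \<in> ?I" "\<forall>T\<in>?I. S \<subseteq> T \<longrightarrow> T = S"
    using finite_has_maximal[of ?I] by blast
  then show ?thesis by (auto simp: maximal_independent_set_def)
qed

definition cartesian_graph_product ::
  "'a pair_pre_digraph \<Rightarrow> 'b pair_pre_digraph \<Rightarrow> ('a \<times> 'b) pair_pre_digraph" where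
  "cartesian_graph_product G H =
     \<lparr> pverts = pverts G \<times> pverts H,
       parcs = {((u, v), (u', v')).
         (u = u' \<and> u \<in> pverts G \<and> (v, v') \<in> parcs H) \<or>
         (v = v' \<and> v \<in> pverts H \<and> (u, u') \<in> parcs G)} \<rparr>"

definition path_graph :: "nat \<Rightarrow> nat pair_pre_digraph" where
  "path_graph n =
     \<lparr> pverts = {1..n},
       parcs = {(i, j). i \<in> {1..n} \<and> j \<in> {1..n} \<and> (j = i + 1 \<or> i = j + 1)} \<rparr>"

datatype rail = Rail_x | Rail_y

definition K2 :: "rail pair_pre_digraph" where
  "K2 = \<lparr> pverts = {Rail_x, Rail_y}, parcs = {(Rail_x, Rail_y), (Rail_y, Rail_x)} \<rparr>"

text \<open>The vertices \<open>x\<^sub>i\<close> and \<open>y\<^sub>i\<close> are \<open>(Rail_x, i)\<close> and \<open>(Rail_y, i)\<close>, with \<open>1 \<le> i \<le> n\<close>.\<close>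

definition ladder :: "nat \<Rightarrow> (rail \<times> nat) pair_pre_digraph" where
  "ladder n = cartesian_graph_product K2 (path_graph n)"

lemma pverts_ladder:
  "pverts (ladder n) = {(Rail_x, i) |i. i \<in> {1..n}} \<union> {(Rail_y, i) |i. i \<in> {1..n}}"
  by (auto simp: ladder_def cartesian_graph_product_def K2_def path_graph_def)

lemma parcs_ladder:
  fixes n :: nat
  defines "E \<equiv> {((Rail_x, i), (Rail_y, i)) |i. 1 \<le> i \<and> i \<le> n}
    \<union> {((Rail_x, i), (Rail_x, i + 1)) |i. 1 \<le> i \<and> i + 1 \<le> n}
    \<union> {((Rail_y, i), (Rail_y, i + 1)) |i. 1 \<le> i \<and> i + 1 \<le> n}"
  shows "parcs (ladder n) = E \<union> E\<inverse>"
  by (auto simp: E_def ladder_def cartesian_graph_product_def K2_def path_graph_def)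

lemma complete_K2: "K\<^bsub>2\<^esub> (with_proj K2)"
  unfolding complete_digraph_def
proof
  show "graph (with_proj K2)"
    by unfold_locales (auto simp: K2_def symmetric_def arcs_ends_conv sym_def arc_to_ends_def)
qed (auto simp: K2_def arcs_ends_conv)

lemma graph_ladder: "graph (with_proj (ladder n))"
proof -
  have "pverts (ladder n) = {Rail_x, Rail_y} \<times> {1..n}"
    by (auto simp: ladder_def cartesian_graph_product_def K2_def path_graph_def)
  then have fin: "finite (pverts (ladder n))" by simp
  have sub: "parcs (ladder n) \<subseteq> pverts (ladder n) \<times> pverts (ladder n)"
    by (auto simp: ladder_def cartesian_graph_product_def K2_def path_graph_def)
  have irr: "u \<noteq> v" if "(u, v) \<in> parcs (ladder n)" for u v
    using that
    by (auto simp: ladder_def cartesian_graph_product_def K2_def path_graph_def)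
  have "sym (parcs (ladder n))"
    by (auto simp: sym_def parcs_ladder)
  moreover have "finite (parcs (ladder n))"
    using finite_subset[OF sub] fin by simp
  ultimately show ?thesis
    using fin sub irr
    by unfold_locales (auto simp: symmetric_def arcs_ends_conv arc_to_ends_def)
qed

end

theory Submission
  imports Defs
begin

text \<open>
  A maximal independent set is the same thing as an independent dominating set
  (\<open>maximal_independent_set_iff_dominating\<close>), so the claim is about covering the ladder by
  closed neighbourhoods of independent vertices. Note that
  \<open>\<lceil>(n + 1) / 2\<rceil> = n div 2 + 1\<close>.

  \<^emph>\<open>Lower bound.\<close> A closed neighbourhood contains at most four vertices, so covering the
  \<open>2n\<close> vertices takes at least \<open>n / 2\<close> of them; a little waste at the left end is what turns this
  into \<open>(n + 1) / 2\<close>. An independent dominating set \<open>S\<close> must contain \<open>x\<^sub>1\<close> or \<open>y\<^sub>1\<close>: otherwise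
  \<open>x\<^sub>1\<close> can only be dominated by \<open>x\<^sub>2\<close> and \<open>y\<^sub>1\<close> only by \<open>y\<^sub>2\<close>, and these two are adjacent.
  Regard the ladder as part of a longer one with an additional column \<open>0\<close>.
  There the neighbourhoods of \<open>S\<close> cover a vertex of column \<open>0\<close> besides the \<open>2n\<close> vertices of the
  ladder, whence \<open>4 |S| \<ge> 2n + 1\<close>, that is \<open>2 |S| \<ge> n + 1\<close>.

  \<^emph>\<open>Upper bound.\<close> The vertices \<open>x\<^sub>1, y\<^sub>3, x\<^sub>5, y\<^sub>7, \<dots>\<close> are independent, and their closed
  neighbourhoods tile a ladder without a right end. If \<open>n\<close> is odd, the sequence can be stopped at
  column \<open>n\<close>. If \<open>n\<close> is even, one vertex of column \<open>n\<close> would be covered only from column \<open>n + 1\<close>;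
  the covering vertex is pulled back into column \<open>n\<close>. In both cases
  \<open>n div 2 + 1\<close> vertices are used.
\<close>

text \<open>Maximality only has to be tested against adding a single vertex, and a vertex outside an
  independent set can be added exactly if it has no neighbour in the set.\<close>

lemma maximal_independent_set_iff_dominating:
  assumes "graph G"
  shows "maximal_independent_set G S \<longleftrightarrow>
    independent_set G S \<and> (\<forall>v \<in> verts G - S. \<exists>u\<in>S. u \<rightarrow>\<^bsub>G\<^esub> v)"
proof -
  interpret graph G by fact
  have sym: "u \<rightarrow>\<^bsub>G\<^esub> v \<Longrightarrow> v \<rightarrow>\<^bsub>G\<^esub> u" for u v
    using sym_arcs by (auto simp: symmetric_def sym_def)
  have irrefl: "\<not> u \<rightarrow>\<^bsub>G\<^esub> u" for u
    using adj_not_same by blast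
  show ?thesis
  proof (intro iffI conjI ballI)
    assume max: "maximal_independent_set G S"
    then show ind: "independent_set G S"
      by (simp add: maximal_independent_set_def)
    fix v assume v: "v \<in> verts G - S"
    then have "\<not> independent_set G (insert v S)"
      using max by (auto simp: maximal_independent_set_def)
    then show "\<exists>u\<in>S. u \<rightarrow>\<^bsub>G\<^esub> v"
      using ind v sym irrefl by (auto simp: independent_set_def)
  next
    assume "independent_set G S \<and> (\<forall>v \<in> verts G - S. \<exists>u\<in>S. u \<rightarrow>\<^bsub>G\<^esub> v)"
    then show "maximal_independent_set G S"
      unfolding maximal_independent_set_def independent_set_def by blast
  qed
qed

lemma UNIV_rail: "UNIV = {Rail_x, Rail_y}"
  using rail.exhaust by auto

lemma verts_ladder: "verts (with_proj (ladder n)) = UNIV \<times> {1..n}"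
  by (auto simp: pverts_ladder UNIV_rail)

lemma adj_ladder_iff:
  "(r, i) \<rightarrow>\<^bsub>with_proj (ladder n)\<^esub> (s, j) \<longleftrightarrow>
    i \<in> {1..n} \<and> j \<in> {1..n} \<and> (if r = s then j = i + 1 \<or> i = j + 1 else i = j)"
  by (cases r; cases s)
    (auto simp: arcs_ends_conv ladder_def cartesian_graph_product_def K2_def path_graph_def)

lemma maximal_independent_set_ladder_first_column:
  assumes "maximal_independent_set (with_proj (ladder n)) S" and "n \<ge> 1"
  obtains r where "(r, 1) \<in> S"
proof (rule ccontr)
  assume "\<not> thesis"
  then have none: "(r, 1) \<notin> S" for r
    using that by blast
  have ind: "independent_set (with_proj (ladder n)) S"
    and dom: "\<forall>v \<in> UNIV \<times> {1..n} - S. \<exists>u\<in>S. u \<rightarrow>\<^bsub>with_proj (ladder n)\<^esub> v"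
    using assms(1)
    unfolding maximal_independent_set_iff_dominating[OF graph_ladder] verts_ladder by blast+
  have second: "(r, 2) \<in> S \<and> 2 \<le> n" for r
  proof -
    have "(r, 1) \<in> UNIV \<times> {1..n} - S"
      using none \<open>n \<ge> 1\<close> by auto
    then obtain s i where si: "(s, i) \<in> S" "(s, i) \<rightarrow>\<^bsub>with_proj (ladder n)\<^esub> (r, 1)"
      using dom by (metis surj_pair)
    then have "i \<noteq> 1" using none by auto
    with si have "s = r \<and> i = 2 \<and> i \<le> n"
      unfolding adj_ladder_iff by (auto split: if_splits)
    with si show ?thesis by auto
  qed
  have "(Rail_x, 2) \<rightarrow>\<^bsub>with_proj (ladder n)\<^esub> (Rail_y, 2)"
    using second by (simp add: adj_ladder_iff del: with_proj_simps)
  then show False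
    using ind second unfolding independent_set_def by blast
qed

text \<open>The closed neighbourhood of a vertex of column at least \<open>1\<close> in the ladder that has an
  additional column \<open>0\<close> and no right end.\<close>

fun extended_nbhd :: "rail \<times> nat \<Rightarrow> (rail \<times> nat) set" where
  "extended_nbhd (r, i) = {(Rail_x, i), (Rail_y, i), (r, i - 1), (r, i + 1)}"

lemma finite_extended_nbhd: "finite (extended_nbhd v)"
  by (cases v) simp

lemma card_extended_nbhd: "card (extended_nbhd v) \<le> 4"
  by (cases v) (simp add: card_insert_if)

lemma adj_ladder_imp_extended_nbhd:
  assumes "u \<rightarrow>\<^bsub>with_proj (ladder n)\<^esub> v"
  shows "v \<in> extended_nbhd u"
proof -
  obtain r i s j where "u = (r, i)" "v = (s, j)"
    by (metis surj_pair)
  then show ?thesis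
    using assms by (cases s) (auto simp: adj_ladder_iff simp del: with_proj_simps split: if_splits)
qed

lemma maximal_independent_set_ladder_lower_bound:
  assumes max: "maximal_independent_set (with_proj (ladder n)) S" and "n \<ge> 1"
  shows "n + 1 \<le> 2 * card S"
proof -
  let ?V = "(UNIV :: rail set) \<times> {1..n}"
  have S: "S \<subseteq> ?V" and dom: "\<forall>v \<in> ?V - S. \<exists>u\<in>S. u \<rightarrow>\<^bsub>with_proj (ladder n)\<^esub> v"
    using max
    unfolding maximal_independent_set_iff_dominating[OF graph_ladder] independent_set_def
      verts_ladder
    by blast+
  have "finite S"
    using S by (rule finite_subset) (simp add: UNIV_rail)
  obtain r where r: "(r, 1) \<in> S"
    using maximal_independent_set_ladder_first_column[OF assms] .
  have self: "v \<in> extended_nbhd v" for v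
    by (cases v; cases "fst v") auto
  have "?V \<subseteq> (\<Union>v\<in>S. extended_nbhd v)"
  proof
    fix v assume v: "v \<in> ?V"
    show "v \<in> (\<Union>v\<in>S. extended_nbhd v)"
    proof (cases "v \<in> S")
      case True
      then show ?thesis using self by (rule UN_I)
    next
      case False
      with v dom obtain u where "u \<in> S" "u \<rightarrow>\<^bsub>with_proj (ladder n)\<^esub> v"
        by (meson DiffI)
      then show ?thesis
        using adj_ladder_imp_extended_nbhd by (intro UN_I)
    qed
  qed
  moreover have "(r, 0) \<in> (\<Union>v\<in>S. extended_nbhd v)"
    using r by (intro UN_I[of "(r, 1)"]) auto
  ultimately have "card (insert (r, 0) ?V) \<le> card (\<Union>v\<in>S. extended_nbhd v)"
    using \<open>finite S\<close> finite_extended_nbhd by (intro card_mono) auto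
  also have "\<dots> \<le> (\<Sum>v\<in>S. card (extended_nbhd v))"
    using \<open>finite S\<close> by (rule card_UN_le)
  also have "\<dots> \<le> (\<Sum>v\<in>S. 4)"
    by (intro sum_mono card_extended_nbhd)
  also have "card (insert (r, 0) ?V) = 2 * n + 1"
    by (simp add: card_cartesian_product UNIV_rail)
  finally show ?thesis by simp
qed

text \<open>The cap at \<open>n\<close> matters only for even \<open>n\<close>, where it moves the last vertex of the
  alternating sequence from column \<open>n + 1\<close> to column \<open>n\<close>.\<close>

definition zigzag_vertex :: "nat \<Rightarrow> nat \<Rightarrow> rail \<times> nat" where
  "zigzag_vertex n k = (if even k then Rail_x else Rail_y, min (2 * k + 1) n)"

lemma zigzag_vertices_not_adj:
  assumes "k \<le> n div 2" and "l \<le> n div 2"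
  shows "\<not> zigzag_vertex n k \<rightarrow>\<^bsub>with_proj (ladder n)\<^esub> zigzag_vertex n l"
proof (cases "even k = even l")
  case True
  \<comment> \<open>Indices of equal parity differ by at least two, and hence the columns by at least three,
    unless they coincide.\<close>
  then have "k = l \<or> k + 2 \<le> l \<or> l + 2 \<le> k"
    by presburger
  with True assms show ?thesis
    by (auto simp: zigzag_vertex_def adj_ladder_iff min_def simp del: with_proj_simps)
next
  case False
  then have "k < l \<or> l < k"
    by (metis nat_neq_iff)
  then have "min (2 * k + 1) n \<noteq> min (2 * l + 1) n"
    using assms by (auto simp: min_def)
  with False show ?thesis
    by (simp add: zigzag_vertex_def adj_ladder_iff del: with_proj_simps)
qed

lemma zigzag_vertices_dominate:
  assumes i: "1 \<le> i" "i \<le> n" and notin: "(r, i) \<notin> zigzag_vertex n ` {..n div 2}"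
  shows "\<exists>k \<le> n div 2. zigzag_vertex n k \<rightarrow>\<^bsub>with_proj (ladder n)\<^esub> (r, i)"
proof (cases "odd i")
  case True
  then obtain k where k: "i = 2 * k + 1"
    by (elim oddE)
  with i have "k \<le> n div 2" by linarith
  with notin have "(r, i) \<noteq> zigzag_vertex n k" by auto
  with i k \<open>k \<le> n div 2\<close> show ?thesis
    by (intro exI[of _ k])
      (auto simp: zigzag_vertex_def adj_ladder_iff min_def simp del: with_proj_simps)
next
  case False
  with i obtain k where k: "i = 2 * k + 2"
    by (intro that[of "i div 2 - 1"]) (auto elim: evenE)
  with i have Suc_k: "Suc k \<le> n div 2" by linarith
  \<comment> \<open>The vertices with indices \<open>k\<close> and \<open>k + 1\<close> lie on opposite rails, on either side of
    column \<open>i\<close>; the one on rail \<open>r\<close> dominates.\<close>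
  show ?thesis
  proof (cases "r = fst (zigzag_vertex n k)")
    case True
    with i k Suc_k show ?thesis
      by (intro exI[of _ k])
        (auto simp: zigzag_vertex_def adj_ladder_iff min_def simp del: with_proj_simps)
  next
    case False
    then have r: "r = fst (zigzag_vertex n (Suc k))"
      by (cases r) (auto simp: zigzag_vertex_def split: if_splits)
    have "(r, i) \<noteq> zigzag_vertex n (Suc k)"
      using notin Suc_k by auto
    with r i k Suc_k show ?thesis
      by (intro exI[of _ "Suc k"])
        (auto simp: zigzag_vertex_def adj_ladder_iff min_def simp del: with_proj_simps
          split: if_splits)
  qed
qed

lemma maximal_independent_set_zigzag:
  assumes "n \<ge> 1"
  shows "maximal_independent_set (with_proj (ladder n)) (zigzag_vertex n ` {..n div 2})"
  unfolding maximal_independent_set_iff_dominating[OF graph_ladder] independent_set_def verts_ladder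
proof (intro conjI ballI)
  show "zigzag_vertex n ` {..n div 2} \<subseteq> UNIV \<times> {1..n}"
    using assms by (auto simp: zigzag_vertex_def)
next
  fix u v assume "u \<in> zigzag_vertex n ` {..n div 2}" "v \<in> zigzag_vertex n ` {..n div 2}"
  then show "\<not> u \<rightarrow>\<^bsub>with_proj (ladder n)\<^esub> v"
    using zigzag_vertices_not_adj by blast
next
  fix v assume "v \<in> UNIV \<times> {1..n} - zigzag_vertex n ` {..n div 2}"
  then show "\<exists>u \<in> zigzag_vertex n ` {..n div 2}. u \<rightarrow>\<^bsub>with_proj (ladder n)\<^esub> v"
    using zigzag_vertices_dominate by (cases v) fastforce
qed

theorem proposition1p28:
  fixes n :: nat
  assumes "n \<ge> 1"
  shows "int (\<mu> (with_proj (ladder n))) = \<lceil>(real n + 1) / 2\<rceil>"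
proof -
  let ?G = "with_proj (ladder n)"
  let ?Z = "zigzag_vertex n ` {..n div 2}"
  have lower: "n div 2 + 1 \<le> card S" if "maximal_independent_set ?G S" for S
    using maximal_independent_set_ladder_lower_bound[OF that assms] by linarith
  have Z: "maximal_independent_set ?G ?Z"
    using assms by (rule maximal_independent_set_zigzag)
  have "card ?Z = n div 2 + 1"
    using lower[OF Z] card_image_le[of "{..n div 2}" "zigzag_vertex n"] by simp
  have "finite (verts ?G)"
    unfolding verts_ladder by (simp add: UNIV_rail)
  then have "finite {S. maximal_independent_set ?G S}"
    by (rule finite_maximal_independent_sets)
  then have "\<mu> ?G = n div 2 + 1"
    unfolding min_maximal_independent_def
  proof (intro Min_eqI)
    show "n div 2 + 1 \<in> card ` {S. maximal_independent_set ?G S}"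
      using Z \<open>card ?Z = n div 2 + 1\<close> by (metis image_eqI mem_Collect_eq)
  qed (use lower in auto)
  moreover have "\<lceil>(real n + 1) / 2\<rceil> = int (n div 2 + 1)"
    by (cases "even n") (auto elim!: evenE oddE intro!: ceiling_unique simp: field_simps)
  ultimately show ?thesis by simp
qed

end
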